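(* Let $K$ be a closed convex cone in $\mathbb{R}^n$ and let $K^*=\{y\in\mathbb{R}^n:\langle x,y\rangle\ge 0\text{ for all }x\in K\}$ be its dual cone, such that $K\subseteq K^*$. Let $\preccurlyeq_K$ and $\leq_*$ be the partial orderings on $\mathbb{R}^n$ determined by the cones $K$ and $K^*$, respectively. Then $V=(\mathbb{R}^n,\leq_*,\preccurlyeq_K)$ is a generalized mixed lattice structure, and for every $x\in\mathbb{R}^n$ the projection element $P_Kx$ satisfies $P_Kx\in \mathrm{Min}[0\curlyvee x]$.
   Context: A subset $C$ of a real vector space is called a cone if $tC\subseteq C$ for all $t\ge 0$, $C+C\subseteq C$ and $C\cap(-C)=\{0\}$. Both $K$ and $K^*$ are cones in this sense, so that both determine partial orderings: $x\preccurlyeq_K y$ means $y-x\in K$, and $x\leq_* y$ means $y-x\in K^*$. $\langle\cdot,\cdot\rangle$ is the standard inner product on $\mathbb{R}^n$ and $\|\cdot\|$ its norm. $P_Kx$ denotes the unique point of $K$ nearest to $x$, i.e. $P_Kx\in K$ and $\|x-P_Kx\|=\inf\{\|x-y\|:y\in K\}$. Let $V$ be a real vector space with two partial orderings $\leq$ and $\preccurlyeq$, both compatible with the linear structure, with positive cones $V_p=\{v:v\geq 0\}$ and $V_{sp}=\{v:v\succcurlyeq 0\}$, respectively. For $x,y\in V$ put $[x\curlyvee y]=\{w\in V: w\succcurlyeq x\text{ and }w\geq y\}$ and $[x\curlywedge y]=\{w\in V: w\preccurlyeq x\text{ and }w\leq y\}$. $\mathrm{Min}[x\curlyvee y]$ denotes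 the set of minimal elements of $[x\curlyvee y]$ with respect to $\leq$ (elements $u$ of the set such that $w$ in the set and $w\leq u$ imply $w=u$), and $\mathrm{Max}[x\curlywedge y]$ denotes the set of maximal elements of $[x\curlywedge y]$ with respect to $\leq$. $V=(V,\leq,\preccurlyeq)$ is called a generalized mixed lattice structure if $V_{sp}\subseteq V_p$ and the sets $\mathrm{Min}[x\curlyvee y]$ and $\mathrm{Max}[x\curlywedge y]$ are non-empty for all $x,y\in V$. In the present case $\leq$ is $\leq_*$ and $\preccurlyeq$ is $\preccurlyeq_K$. *)

theory Defs
  imports "HOL-Analysis.Analysis"
begin

text \<open>The library's \<^const>\<open>cone\<close> only requires closure under multiplication by nonnegative
  scalars, and holds of the empty set. Here a cone is moreover closed under addition and pointed;
  the last condition also forces it to contain \<open>0\<close>.\<close>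

definition ordering_cone :: "'a::real_vector set \<Rightarrow> bool" where
  "ordering_cone C \<longleftrightarrow>
     cone C \<and> (\<forall>x\<in>C. \<forall>y\<in>C. x + y \<in> C) \<and> C \<inter> uminus ` C = {0}"

definition dual_cone :: "'a::real_inner set \<Rightarrow> 'a set" where
  "dual_cone K = {y. \<forall>x\<in>K. 0 \<le> x \<bullet> y}"

definition cone_le :: "'a::real_vector set \<Rightarrow> 'a \<Rightarrow> 'a \<Rightarrow> bool" where
  "cone_le C x y \<longleftrightarrow> y - x \<in> C"

definition linear_partial_order :: "('a::real_vector \<Rightarrow> 'a \<Rightarrow> bool) \<Rightarrow> bool" where
  "linear_partial_order le \<longleftrightarrow>
     reflp le \<and> antisymp le \<and> transp le \<and>
     (\<forall>x y z. le x y \<longrightarrow> le (x + z) (y + z)) \<and>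
     (\<forall>x y. \<forall>t\<ge>0. le x y \<longrightarrow> le (t *\<^sub>R x) (t *\<^sub>R y))"

text \<open>In all that follows, \<open>le\<close> is the order \<open>\<le>\<close> and \<open>sle\<close> the specific order \<open>\<preceq>\<close>.
  The sets of mixed upper and lower bounds are not symmetric in \<open>x\<close> and \<open>y\<close>: the first argument
  is compared by \<open>sle\<close> and the second by \<open>le\<close>.\<close>

definition mixed_upper ::
  "('a \<Rightarrow> 'a \<Rightarrow> bool) \<Rightarrow> ('a \<Rightarrow> 'a \<Rightarrow> bool) \<Rightarrow> 'a \<Rightarrow> 'a \<Rightarrow> 'a set" where
  "mixed_upper le sle x y = {w. sle x w \<and> le y w}"

definition mixed_lower ::
  "('a \<Rightarrow> 'a \<Rightarrow> bool) \<Rightarrow> ('a \<Rightarrow> 'a \<Rightarrow> bool) \<Rightarrow> 'a \<Rightarrow> 'a \<Rightarrow> 'a set" where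
  "mixed_lower le sle x y = {w. sle w x \<and> le w y}"

definition minimal_elements :: "('a \<Rightarrow> 'a \<Rightarrow> bool) \<Rightarrow> 'a set \<Rightarrow> 'a set" where
  "minimal_elements le A = {u\<in>A. \<forall>w\<in>A. le w u \<longrightarrow> w = u}"

definition maximal_elements :: "('a \<Rightarrow> 'a \<Rightarrow> bool) \<Rightarrow> 'a set \<Rightarrow> 'a set" where
  "maximal_elements le A = {u\<in>A. \<forall>w\<in>A. le u w \<longrightarrow> w = u}"

definition generalized_mixed_lattice ::
  "('a::real_vector \<Rightarrow> 'a \<Rightarrow> bool) \<Rightarrow> ('a \<Rightarrow> 'a \<Rightarrow> bool) \<Rightarrow> bool" where
  "generalized_mixed_lattice le sle \<longleftrightarrow>
     linear_partial_order le \<and> linear_partial_order sle \<and>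
     {v. sle 0 v} \<subseteq> {v. le 0 v} \<and>
     (\<forall>x y. minimal_elements le (mixed_upper le sle x y) \<noteq> {} \<and>
            maximal_elements le (mixed_lower le sle x y) \<noteq> {})"

end

theory Submission
  imports Defs
begin

text \<open>By Moreau's characterisation of the projection \<open>P\<close> of \<open>x\<close> onto \<open>K\<close>, \<open>P - x\<close> lies in
  \<open>K\<^sup>*\<close> and is orthogonal to \<open>P\<close>. If \<open>w \<in> K\<close> with \<open>w - x \<in> K\<^sup>*\<close> and \<open>P - w \<in> K\<^sup>*\<close>, pairing these
  elements of \<open>K\<^sup>*\<close> with \<open>P\<close> and \<open>w\<close> gives \<open>w \<bullet> P = P \<bullet> P \<ge> w \<bullet> w\<close>, hence \<open>w = P\<close>.
  Translation and reflection carry this case, with mixed upper bounds of \<open>0\<close> and \<open>x\<close>, to mixed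
  upper and lower bounds of arbitrary pairs.\<close>

lemma linear_partial_order_cone_le:
  assumes "ordering_cone C"
  shows "linear_partial_order (cone_le C)"
proof -
  have cone: "\<And>t v. t \<ge> 0 \<Longrightarrow> v \<in> C \<Longrightarrow> t *\<^sub>R v \<in> C"
    and add: "\<And>u v. u \<in> C \<Longrightarrow> v \<in> C \<Longrightarrow> u + v \<in> C"
    and pointed: "C \<inter> uminus ` C = {0}"
    using assms unfolding ordering_cone_def cone_def by blast+
  have "0 \<in> C" using pointed by blast
  moreover have "x = y" if "y - x \<in> C" "x - y \<in> C" for x y
  proof -
    have "y - x = - (x - y)" by simp
    then have "y - x \<in> C \<inter> uminus ` C" using that by blast
    then show ?thesis using pointed by simp
  qed
  moreover have "z - x \<in> C" if "y - x \<in> C" "z - y \<in> C" for x y z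
    using add[OF that] by simp
  moreover have "t *\<^sub>R y - t *\<^sub>R x \<in> C" if "t \<ge> 0" "y - x \<in> C" for x y t
    using cone[OF that] by (simp add: scaleR_diff_right)
  ultimately show ?thesis
    unfolding linear_partial_order_def cone_le_def
    by (auto intro!: reflpI antisympI transpI)
qed

text \<open>The whole ray through the projection \<open>P\<close> lies in \<open>K\<close>, so the
  variational inequality can be tested along it on both sides of \<open>P\<close>.\<close>

lemma closest_point_cone_orthogonal:
  fixes K :: "'a::euclidean_space set"
  assumes "closed K" "convex K" "cone K" "K \<noteq> {}"
  shows "(closest_point K x - x) \<bullet> closest_point K x = 0"
proof -
  define P where "P = closest_point K x"
  have P: "P \<in> K" unfolding P_def using assms by (simp add: closest_point_in_set)
  have *: "(x - P) \<bullet> (t *\<^sub>R P - P) \<le> 0" if "t \<ge> 0" for t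
    unfolding P_def
    by (rule closest_point_dot[OF assms(2,1)]) (use assms P that in \<open>simp add: cone_def P_def\<close>)
  show ?thesis
    \<comment> \<open>At \<open>t = 0\<close> and \<open>t = 2\<close> the direction
      \<open>t *\<^sub>R P - P\<close> is \<open>- P\<close> and \<open>P\<close>, so the inner
      product is bounded by 0 from both sides.\<close>
    using *[of 0] *[of 2] unfolding P_def[symmetric]
    by (simp add: inner_diff_left inner_diff_right)
qed

text \<open>Orthogonality removes the \<open>P\<close> term from the variational inequality
  \<open>(x - P) \<bullet> (k - P) \<le> 0\<close>, which leaves exactly the dual cone condition at
  \<open>k\<close>.\<close>

lemma closest_point_cone_diff_in_dual:
  fixes K :: "'a::euclidean_space set"
  assumes "closed K" "convex K" "cone K" "K \<noteq> {}"
  shows "closest_point K x - x \<in> dual_cone K"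
  unfolding dual_cone_def
proof (intro CollectI ballI)
  fix k assume "k \<in> K"
  then have "(x - closest_point K x) \<bullet> (k - closest_point K x) \<le> 0"
    by (rule closest_point_dot[OF assms(2,1)])
  with closest_point_cone_orthogonal[OF assms, of x]
  show "0 \<le> k \<bullet> (closest_point K x - x)"
    by (simp add: inner_diff_left inner_diff_right inner_commute)
qed

lemma closest_point_cone_unique_below:
  fixes K :: "'a::euclidean_space set"
  assumes "closed K" "convex K" "cone K"
    and w: "w \<in> K" "w - x \<in> dual_cone K" "closest_point K x - w \<in> dual_cone K"
  shows "w = closest_point K x"
proof -
  define P where "P = closest_point K x"
  have "K \<noteq> {}" using w by blast
  then have P: "P \<in> K" and orth: "(P - x) \<bullet> P = 0"
    using assms closest_point_cone_orthogonal[of K x]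
    by (simp_all add: closest_point_in_set P_def)
  have "0 \<le> P \<bullet> (w - x)" "0 \<le> P \<bullet> (P - w)" "0 \<le> w \<bullet> (P - w)"
    using w P by (auto simp: dual_cone_def P_def)
  \<comment> \<open>Split the square as \<open>P \<bullet> (P - w) - w \<bullet> (P - w)\<close>.
    Since \<open>P \<bullet> x = P \<bullet> P\<close>, the first term equals
    \<open>- (P \<bullet> (w - x))\<close>, so neither contribution is positive.\<close>
  then have "(P - w) \<bullet> (P - w) \<le> 0"
    using orth by (simp add: inner_diff_left inner_diff_right inner_commute)
  then show ?thesis unfolding P_def[symmetric] using inner_gt_zero_iff[of "P - w"] by fastforce
qed

text \<open>The translation \<open>w \<mapsto> w - x\<close> carries the mixed upper bounds of
  \<open>x\<close> and \<open>y\<close> to those of \<open>0\<close> and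
  \<open>y - x\<close>.\<close>

lemma minimal_mixed_upper_closest_point:
  fixes K :: "'a::euclidean_space set"
  assumes "closed K" "convex K" "cone K" "K \<noteq> {}"
  shows "x + closest_point K (y - x) \<in> minimal_elements (cone_le (dual_cone K))
    (mixed_upper (cone_le (dual_cone K)) (cone_le K) x y)"
proof -
  define P where "P = closest_point K (y - x)"
  have "P \<in> K" "P - (y - x) \<in> dual_cone K"
    using assms closest_point_cone_diff_in_dual[OF assms, of "y - x"]
    by (simp_all add: P_def closest_point_in_set)
  moreover have "w = x + P"
    if "w - x \<in> K" "w - y \<in> dual_cone K" "x + P - w \<in> dual_cone K" for w
    using closest_point_cone_unique_below[OF assms(1-3), of "w - x" "y - x"] that
    by (simp add: P_def algebra_simps)
  ultimately show ?thesis
    unfolding P_def[symmetric] minimal_elements_def mixed_upper_def cone_le_def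
    by (auto simp: algebra_simps)
qed

text \<open>The reflection \<open>w \<mapsto> x - w\<close> turns mixed lower bounds of
  \<open>x\<close> and \<open>y\<close> into mixed upper bounds of \<open>0\<close> and
  \<open>x - y\<close>. It reverses the order, so minimal elements become maximal.\<close>

lemma maximal_mixed_lower_closest_point:
  fixes K :: "'a::euclidean_space set"
  assumes "closed K" "convex K" "cone K" "K \<noteq> {}"
  shows "x - closest_point K (x - y) \<in> maximal_elements (cone_le (dual_cone K))
    (mixed_lower (cone_le (dual_cone K)) (cone_le K) x y)"
proof -
  define P where "P = closest_point K (x - y)"
  have "P \<in> K" "P - (x - y) \<in> dual_cone K"
    using assms closest_point_cone_diff_in_dual[OF assms, of "x - y"]
    by (simp_all add: P_def closest_point_in_set)
  moreover have "w = x - P"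
    if "x - w \<in> K" "y - w \<in> dual_cone K" "w - (x - P) \<in> dual_cone K" for w
    using closest_point_cone_unique_below[OF assms(1-3), of "x - w" "x - y"] that
    by (simp add: P_def algebra_simps)
  ultimately show ?thesis
    unfolding P_def[symmetric] maximal_elements_def mixed_lower_def cone_le_def
    by (auto simp: algebra_simps)
qed

theorem theorem4p1:
  fixes K :: "(real ^ 'n) set"
  assumes "closed K" and "convex K" and "ordering_cone K"
    and "ordering_cone (dual_cone K)"
    and "K \<subseteq> dual_cone K"
  shows "generalized_mixed_lattice (cone_le (dual_cone K)) (cone_le K) \<and>
    (\<forall>x. closest_point K x \<in>
      minimal_elements (cone_le (dual_cone K))
        (mixed_upper (cone_le (dual_cone K)) (cone_le K) 0 x))"
proof -
  have K: "closed K" "convex K" "cone K" "K \<noteq> {}"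
    using assms unfolding ordering_cone_def by auto
  note upper = minimal_mixed_upper_closest_point[OF K]
  note lower = maximal_mixed_lower_closest_point[OF K]
  have "{v. cone_le K 0 v} \<subseteq> {v. cone_le (dual_cone K) 0 v}"
    using assms(5) by (auto simp: cone_le_def)
  then have "generalized_mixed_lattice (cone_le (dual_cone K)) (cone_le K)"
    unfolding generalized_mixed_lattice_def
    using linear_partial_order_cone_le assms(3,4) upper lower by blast
  \<comment> \<open>With base point \<open>0\<close> the minimal element found above is the
    projection itself.\<close>
  then show ?thesis using upper[of 0] by simp
qed

end
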